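(* For every positive integer $n$, $C_n=a(n+1)$, where $a$ is the OEIS sequence A182843, i.e. $a(m)$ is the number of composite integers $W\ge m$ all of whose proper divisors are less than $m$.
   Context: $p_1=2<p_2=3<\cdots$ are the primes and $\pi(x)$ is the number of primes $\le x$. $K$ is a field containing $\mathbb{Q}$. For a positive integer $n$ put $r=\pi(n)$ and $S=K[x_1,\dots,x_r]$. The weight of a monomial $m=x_1^{a_1}\cdots x_r^{a_r}$ is $w(m)=\prod_i p_i^{a_i}$. $I_n\subset S$ is the monomial ideal generated by all monomials of weight $>n$, $G(I_n)$ is its minimal monomial generating set, and $C_n=\#G(I_n)$. A proper divisor of $W$ is a positive divisor of $W$ different from $W$. *)

theory Defs
  imports
    "HOL-Algebra.Ideal"
    "HOL-Computational_Algebra.Primes"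
    "HOL-Library.Poly_Mapping"
    "HOL-Library.Infinite_Set"
begin

definition prime_pi :: "nat \<Rightarrow> nat" where
  "prime_pi x = card {p :: nat. prime p \<and> p \<le> x}"

(* The primes are indexed from 1 (so that the first prime is 2), while the library's
   enumeration of a set starts at index 0. *)
definition nth_prime :: "nat \<Rightarrow> nat" where
  "nth_prime i = Infinite_Set.enumerate {p :: nat. prime p} (i - 1)"

lemma nth_prime_1: "nth_prime 1 = 2"
  unfolding nth_prime_def
  by (auto simp: enumerate_0 intro!: Least_equality prime_ge_2_nat)

(* Polynomials in variables indexed by the natural numbers: finitely supported maps from
   exponent vectors to coefficients, with convolution as multiplication. *)
type_synonym 'k mpoly = "(nat \<Rightarrow>\<^sub>0 nat) \<Rightarrow>\<^sub>0 'k"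

definition exponents :: "nat \<Rightarrow> (nat \<Rightarrow>\<^sub>0 nat) set" where
  "exponents r = {e. Poly_Mapping.keys e \<subseteq> {1..r}}"

definition poly_ring :: "nat \<Rightarrow> ('k :: comm_ring_1) mpoly ring" where
  "poly_ring r =
    \<lparr>carrier = {f. Poly_Mapping.keys f \<subseteq> exponents r},
     monoid.mult = (*), one = 1, ring.zero = 0, add = (+)\<rparr>"

definition monomial :: "(nat \<Rightarrow>\<^sub>0 nat) \<Rightarrow> ('k :: comm_ring_1) mpoly" where
  "monomial e = Poly_Mapping.single e 1"

definition weight :: "nat \<Rightarrow> (nat \<Rightarrow>\<^sub>0 nat) \<Rightarrow> nat" where
  "weight r e = (\<Prod>i = 1..r. nth_prime i ^ Poly_Mapping.lookup e i)"

definition weight_ideal :: "nat \<Rightarrow> ('k :: field_char_0) mpoly set" where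
  "weight_ideal n =
    (let r = prime_pi n
     in genideal (poly_ring r) (monomial ` {e \<in> exponents r. weight r e > n}))"

definition is_minimal_monomial_generating_set ::
    "nat \<Rightarrow> ('k :: field_char_0) mpoly set \<Rightarrow> 'k mpoly set \<Rightarrow> bool" where
  "is_minimal_monomial_generating_set r I G \<longleftrightarrow>
    G \<subseteq> monomial ` exponents r \<and> genideal (poly_ring r) G = I \<and>
    (\<forall>H. H \<subset> G \<longrightarrow> genideal (poly_ring r) H \<noteq> I)"

(* Every monomial ideal has exactly one minimal generating set consisting of monomials. *)
definition minimal_monomial_generators ::
    "nat \<Rightarrow> ('k :: field_char_0) mpoly set \<Rightarrow> 'k mpoly set" where
  "minimal_monomial_generators r I = (THE G. is_minimal_monomial_generating_set r I G)"

(* The first argument only carries the coefficient field. *)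
definition num_generators :: "('k :: field_char_0) itself \<Rightarrow> nat \<Rightarrow> nat" where
  "num_generators K n =
    card (minimal_monomial_generators (prime_pi n) (weight_ideal n :: 'k mpoly set))"

definition composite :: "nat \<Rightarrow> bool" where
  "composite W \<longleftrightarrow> W > 1 \<and> \<not> prime W"

definition A182843 :: "nat \<Rightarrow> nat" where
  "A182843 m = card {W. composite W \<and> W \<ge> m \<and> (\<forall>d. d dvd W \<and> d \<noteq> W \<longrightarrow> d < m)}"

lemma finite_A182843:
  "finite {W. composite W \<and> W \<ge> m \<and> (\<forall>d. d dvd W \<and> d \<noteq> W \<longrightarrow> d < m)}"
proof (rule finite_subset)
  show "{W. composite W \<and> W \<ge> m \<and> (\<forall>d. d dvd W \<and> d \<noteq> W \<longrightarrow> d < m)} \<subseteq> {..m * m}"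
  proof
    fix W
    assume "W \<in> {W. composite W \<and> W \<ge> m \<and> (\<forall>d. d dvd W \<and> d \<noteq> W \<longrightarrow> d < m)}"
    then have W: "W > 1" "\<not> prime W" "\<And>d. d dvd W \<Longrightarrow> d \<noteq> W \<Longrightarrow> d < m"
      by (auto simp: composite_def)
    from W(1,2) obtain a where a: "a dvd W" "a \<noteq> 1" "a \<noteq> W"
      by (auto simp: prime_nat_iff)
    then obtain b where b: "W = a * b" by blast
    have "b > 0" using b W(1) by (cases b) auto
    then have "b \<noteq> W" using a b by auto
    moreover have "b dvd W" using b by simp
    ultimately have "a < m" "b < m" using W(3) a by blast+
    then show "W \<in> {..m * m}" using b by (simp add: mult_le_mono)
  qed
qed simp

lemma exponents_add: "a \<in> exponents r \<Longrightarrow> b \<in> exponents r \<Longrightarrow> a + b \<in> exponents r"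
  using Poly_Mapping.keys_add[of a b] by (auto simp: exponents_def)

lemma cring_poly_ring: "cring (poly_ring r :: ('k :: comm_ring_1) mpoly ring)"
proof (rule cringI)
  show "abelian_group (poly_ring r :: 'k mpoly ring)"
  proof (rule abelian_groupI)
    fix f g :: "'k mpoly"
    assume "f \<in> carrier (poly_ring r)" "g \<in> carrier (poly_ring r)"
    then show "f \<oplus>\<^bsub>poly_ring r\<^esub> g \<in> carrier (poly_ring r)"
      using Poly_Mapping.keys_add[of f g] by (auto simp: poly_ring_def)
  next
    fix f :: "'k mpoly"
    assume "f \<in> carrier (poly_ring r)"
    then show "\<exists>g\<in>carrier (poly_ring r). g \<oplus>\<^bsub>poly_ring r\<^esub> f = \<zero>\<^bsub>poly_ring r\<^esub>"
      by (intro bexI[of _ "- f"]) (auto simp: poly_ring_def)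
  qed (auto simp: poly_ring_def algebra_simps)
  show "Group.comm_monoid (poly_ring r :: 'k mpoly ring)"
  proof (rule comm_monoidI)
    fix f g :: "'k mpoly"
    assume "f \<in> carrier (poly_ring r)" "g \<in> carrier (poly_ring r)"
    then show "f \<otimes>\<^bsub>poly_ring r\<^esub> g \<in> carrier (poly_ring r)"
      using Poly_Mapping.keys_mult[of f g] by (fastforce simp: poly_ring_def intro: exponents_add)
  qed (auto simp: poly_ring_def algebra_simps exponents_def)
qed (auto simp: poly_ring_def algebra_simps)

end

theory Submission
  imports Defs
begin

text \<open>A polynomial lies in a monomial ideal iff every exponent vector of its support is a
  multiple of the exponent vector of some generator. Hence generating sets of monomials of \<open>I_n\<close>
  correspond to sets of exponent vectors with upper closure \<open>{e. weight e > n}\<close>, and the unique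
  smallest such set is the set of minimal elements. By unique factorisation the weight maps these
  minimal vectors bijectively to the integers \<open>W > n\<close> whose prime factors are all at most \<open>n\<close>
  and whose proper divisors are all at most \<open>n\<close>. For \<open>W\<close> with the second property, the first one
  says exactly that \<open>W\<close> is composite.\<close>

section \<open>Monomial ideals\<close>

text \<open>For \<open>E\<close> inside \<open>exponents r\<close>, these are the exponent vectors
  of the monomials in the ideal generated by \<open>E\<close>. Divisibility of monomials is written
  additively, and \<open>e \<in> exponents r\<close> confines the cofactor \<open>c\<close> to the
  same variables.\<close>

definition upper :: "nat \<Rightarrow> (nat \<Rightarrow>\<^sub>0 nat) set \<Rightarrow> (nat \<Rightarrow>\<^sub>0 nat) set" where
  "upper r E = {e \<in> exponents r. \<exists>d\<in>E. \<exists>c. e = d + c}"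

definition minimal_exponents :: "(nat \<Rightarrow>\<^sub>0 nat) set \<Rightarrow> (nat \<Rightarrow>\<^sub>0 nat) set" where
  "minimal_exponents A = {e \<in> A. \<forall>d\<in>A. (\<exists>c. e = d + c) \<longrightarrow> d = e}"

text \<open>Exponents are natural numbers, so nothing cancels in a sum and its support is the union
  of the two supports.\<close>

lemma exponents_add_iff: "a + b \<in> exponents r \<longleftrightarrow> a \<in> exponents r \<and> b \<in> exponents r"
  by (auto simp: exponents_def subset_iff in_keys_iff lookup_add)

lemma upperI: "e \<in> E \<Longrightarrow> e \<in> exponents r \<Longrightarrow> e \<in> upper r E"
  by (auto simp: upper_def intro!: bexI[of _ e] exI[of _ 0])

lemma keys_monomial: "Poly_Mapping.keys (monomial e :: 'k :: field_char_0 mpoly) = {e}"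
  by (simp add: monomial_def)

lemma monomial_eq_iff:
  "(monomial d :: 'k :: field_char_0 mpoly) = monomial e \<longleftrightarrow> d = e"
  by (metis keys_monomial singleton_inject)

lemma inj_monomial: "inj (monomial :: _ \<Rightarrow> 'k :: field_char_0 mpoly)"
  by (simp add: inj_def monomial_eq_iff)

text \<open>Serves to bound a generated ideal from above. Multiplication only adds exponents, and
  \<open>upper r E\<close> is closed under adding vectors of \<open>exponents r\<close>.\<close>

lemma ideal_supported_upper:
  "ideal {f :: 'k :: field_char_0 mpoly. Poly_Mapping.keys f \<subseteq> upper r E} (poly_ring r)"
proof -
  interpret cring "poly_ring r :: 'k mpoly ring" by (rule cring_poly_ring)
  let ?J = "{f :: 'k mpoly. Poly_Mapping.keys f \<subseteq> upper r E}"
  have mult: "x * f \<in> ?J" if "f \<in> ?J" "x \<in> carrier (poly_ring r)" for f x :: "'k mpoly"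
  proof -
    have "Poly_Mapping.keys (x * f) \<subseteq> {a + b |a b. a \<in> Poly_Mapping.keys x \<and> b \<in> Poly_Mapping.keys f}"
      by (rule Poly_Mapping.keys_mult)
    also have "\<dots> \<subseteq> upper r E"
    proof clarify
      fix a b assume "a \<in> Poly_Mapping.keys x" "b \<in> Poly_Mapping.keys f"
      with that have a: "a \<in> exponents r" and b: "b \<in> upper r E" by (auto simp: poly_ring_def)
      from b obtain d c where d: "d \<in> E" "b = d + c" by (auto simp: upper_def)
      then have "a + b = d + (a + c)" by (simp add: ac_simps)
      moreover have "a + b \<in> exponents r" using a b by (simp add: exponents_add_iff upper_def)
      ultimately show "a + b \<in> upper r E" using d(1) unfolding upper_def by blast
    qed
    finally show ?thesis by simp
  qed
  show ?thesis
  proof (rule idealI)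
    show "ring (poly_ring r :: 'k mpoly ring)" by (rule ring_axioms)
    show "subgroup ?J (add_monoid (poly_ring r))"
    proof (rule add.subgroupI)
      show "?J \<subseteq> carrier (poly_ring r)" by (auto simp: poly_ring_def upper_def)
      show "?J \<noteq> {}" by (auto intro: exI[of _ 0])
      fix f assume f: "f \<in> ?J"
      then have "f \<in> carrier (poly_ring r)" by (auto simp: poly_ring_def upper_def)
      moreover have "- f \<in> carrier (poly_ring r)" using calculation by (simp add: poly_ring_def)
      \<comment> \<open>Negation in the ring structure is derived from its addition; uniqueness of
        inverses identifies it with the negation of polynomials.\<close>
      ultimately have "\<ominus>\<^bsub>poly_ring r\<^esub> f = - f"
        by (intro minus_equality) (auto simp: poly_ring_def)
      with f show "\<ominus>\<^bsub>poly_ring r\<^esub> f \<in> ?J" by simp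
    next
      fix f g assume "f \<in> ?J" "g \<in> ?J"
      then show "f \<oplus>\<^bsub>poly_ring r\<^esub> g \<in> ?J"
        using Poly_Mapping.keys_add[of f g] by (auto simp: poly_ring_def)
    qed
  next
    fix f x :: "'k mpoly" assume "f \<in> ?J" "x \<in> carrier (poly_ring r)"
    with mult show "x \<otimes>\<^bsub>poly_ring r\<^esub> f \<in> ?J" "f \<otimes>\<^bsub>poly_ring r\<^esub> x \<in> ?J"
      by (simp_all add: poly_ring_def mult.commute)
  qed
qed

text \<open>The right-hand side is an ideal containing the generators. Conversely, a term with
  exponent in \<open>upper r E\<close> is a generator times a term, and a polynomial is the finite
  sum of its terms.\<close>

lemma genideal_monomials:
  assumes "E \<subseteq> exponents r"
  shows "genideal (poly_ring r) (monomial ` E :: 'k :: field_char_0 mpoly set) =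
    {f. Poly_Mapping.keys f \<subseteq> upper r E}"
proof
  interpret cring "poly_ring r :: 'k mpoly ring" by (rule cring_poly_ring)
  let ?I = "genideal (poly_ring r) (monomial ` E :: 'k mpoly set)"
  have carr: "monomial ` E \<subseteq> (carrier (poly_ring r) :: 'k mpoly set)"
    using assms by (auto simp: poly_ring_def keys_monomial)
  have E: "E \<subseteq> upper r E"
    using assms by (auto intro: upperI)
  then show "?I \<subseteq> {f. Poly_Mapping.keys f \<subseteq> upper r E}"
    by (intro genideal_minimal ideal_supported_upper) (auto simp: keys_monomial)
  interpret I: ideal ?I "poly_ring r" by (rule genideal_ideal[OF carr])
  have term_in: "Poly_Mapping.single e a \<in> ?I" if e: "e \<in> upper r E" for e and a :: 'k
  proof -
    from e obtain d c where d: "d \<in> E" "e = d + c" "c \<in> exponents r"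
      by (auto simp: upper_def exponents_add_iff)
    have "monomial d \<in> ?I" using genideal_self[OF carr] d by blast
    moreover have "Poly_Mapping.single c a \<in> carrier (poly_ring r)"
      using d by (auto simp: poly_ring_def)
    ultimately have "monomial d \<otimes>\<^bsub>poly_ring r\<^esub> Poly_Mapping.single c a \<in> ?I"
      by (rule I.I_r_closed)
    then show ?thesis by (simp add: poly_ring_def monomial_def mult_single d)
  qed
  have sum_in: "(\<Sum>e\<in>F. Poly_Mapping.single e (Poly_Mapping.lookup f e)) \<in> ?I"
    if "finite F" "F \<subseteq> upper r E" for F and f :: "'k mpoly"
    using that
  proof (induction F)
    case empty
    then show ?case using I.zero_closed by (simp add: poly_ring_def)
  next
    case (insert e F)
    then show ?case
      using I.a_closed[OF term_in[of e "Poly_Mapping.lookup f e"]] by (simp add: poly_ring_def)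
  qed
  show "{f. Poly_Mapping.keys f \<subseteq> upper r E} \<subseteq> ?I"
  proof
    fix f :: "'k mpoly"
    assume "f \<in> {f. Poly_Mapping.keys f \<subseteq> upper r E}"
    then have "(\<Sum>e\<in>Poly_Mapping.keys f. Poly_Mapping.single e (Poly_Mapping.lookup f e)) \<in> ?I"
      by (intro sum_in) simp_all
    moreover have "(\<Sum>e\<in>Poly_Mapping.keys f. Poly_Mapping.single e (Poly_Mapping.lookup f e)) = f"
      by (rule poly_mapping_eqI) (simp add: lookup_sum lookup_single when_def in_keys_iff)
    ultimately show "f \<in> ?I" by simp
  qed
qed

text \<open>The ideal determines the upper set: \<open>e\<close> is in \<open>upper r E\<close> iff
  \<open>monomial e\<close> is in the ideal.\<close>

lemma genideal_monomials_eq_iff: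
  assumes "E \<subseteq> exponents r" "F \<subseteq> exponents r"
  shows "genideal (poly_ring r) (monomial ` E :: 'k :: field_char_0 mpoly set) =
      genideal (poly_ring r) (monomial ` F) \<longleftrightarrow> upper r E = upper r F"
proof
  assume "genideal (poly_ring r) (monomial ` E :: 'k mpoly set) =
    genideal (poly_ring r) (monomial ` F)"
  then have eq: "{f :: 'k mpoly. Poly_Mapping.keys f \<subseteq> upper r E} = {f. Poly_Mapping.keys f \<subseteq> upper r F}"
    by (simp only: genideal_monomials[OF assms(1)] genideal_monomials[OF assms(2)])
  have "e \<in> upper r E \<longleftrightarrow> e \<in> upper r F" for e
    using arg_cong[OF eq, of "\<lambda>J. monomial e \<in> J"] by (simp add: keys_monomial)
  then show "upper r E = upper r F" by blast
next
  assume "upper r E = upper r F"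
  then show "genideal (poly_ring r) (monomial ` E :: 'k mpoly set) =
      genideal (poly_ring r) (monomial ` F)"
    by (simp only: genideal_monomials[OF assms(1)] genideal_monomials[OF assms(2)])
qed

section \<open>Minimal monomial generating sets\<close>

lemma minimal_exponents_subset:
  assumes "upper r F = A"
  shows "minimal_exponents A \<subseteq> F"
proof
  fix e assume e: "e \<in> minimal_exponents A"
  then obtain d c where d: "d \<in> F" "e = d + c" "e \<in> exponents r"
    using assms by (auto simp: minimal_exponents_def upper_def)
  \<comment> \<open>The divisor of \<open>e\<close> found in \<open>F\<close> lies in
    \<open>A\<close> as well, so minimality of \<open>e\<close> makes the two equal.\<close>
  then have "d \<in> A"
    using assms by (auto simp: exponents_add_iff intro: upperI)
  with e d show "e \<in> F" by (auto simp: minimal_exponents_def)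
qed

text \<open>The minimal vectors lie in every exponent set with upper set \<open>A\<close>, and by
  assumption they have this upper set themselves. The equivalence for arbitrary \<open>G\<close>
  gives existence and uniqueness together, as the \<open>THE\<close> in
  \<open>minimal_monomial_generators\<close> requires.\<close>

lemma is_minimal_monomial_generating_set_iff:
  fixes I :: "'k :: field_char_0 mpoly set"
  assumes A: "A \<subseteq> exponents r" "upper r (minimal_exponents A) = A" "upper r A = A"
    and I: "I = genideal (poly_ring r) (monomial ` A)"
  shows "is_minimal_monomial_generating_set r I G \<longleftrightarrow> G = monomial ` minimal_exponents A"
proof -
  let ?M = "minimal_exponents A"
  have M: "?M \<subseteq> exponents r" using A(1) by (auto simp: minimal_exponents_def)
  have gen: "genideal (poly_ring r) (monomial ` F) = I \<longleftrightarrow> upper r F = A"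
    if "F \<subseteq> exponents r" for F
    using genideal_monomials_eq_iff[OF that A(1)] A(3) by (simp add: I)
  have gen_M: "genideal (poly_ring r) (monomial ` ?M) = I" using gen[OF M] A(2) by simp
  show ?thesis
  proof
    assume "is_minimal_monomial_generating_set r I G"
    then have G: "G \<subseteq> monomial ` exponents r" "genideal (poly_ring r) G = I"
      and min: "\<And>H. H \<subset> G \<Longrightarrow> genideal (poly_ring r) H \<noteq> I"
      unfolding is_minimal_monomial_generating_set_def by blast+
    from G(1) obtain F where F: "F \<subseteq> exponents r" "G = monomial ` F"
      by (rule subset_imageE)
    have "upper r F = A" using gen[OF F(1)] G(2) F(2) by simp
    then have "monomial ` ?M \<subseteq> G"
      unfolding F(2) by (intro image_mono minimal_exponents_subset)
    with min[of "monomial ` ?M"] gen_M show "G = monomial ` ?M" by blast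
  next
    assume G: "G = monomial ` ?M"
    have "genideal (poly_ring r) H \<noteq> I" if "H \<subset> G" for H
    proof
      assume H: "genideal (poly_ring r) H = I"
      from that have "H \<subseteq> monomial ` ?M" unfolding G by (rule psubset_imp_subset)
      then obtain F where F: "F \<subseteq> ?M" "H = monomial ` F" by (rule subset_imageE)
      from F(1) M have "F \<subseteq> exponents r" by (rule subset_trans)
      with gen H F(2) have "upper r F = A" by simp
      then have "?M \<subseteq> F" by (rule minimal_exponents_subset)
      with that F G show False by blast
    qed
    with G M gen_M show "is_minimal_monomial_generating_set r I G"
      unfolding is_minimal_monomial_generating_set_def by blast
  qed
qed

section \<open>Weights\<close>

lemma infinite_primes_nat: "infinite {p :: nat. prime p}"
  using primes_infinite by simp

lemma prime_nth_prime: "prime (nth_prime i)"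
  using enumerate_in_set[OF infinite_primes_nat, of "i - 1"] by (simp add: nth_prime_def)

lemma inj_on_nth_prime: "inj_on nth_prime {1..r}"
proof (rule inj_onI)
  fix i j assume "i \<in> {1..r}" "j \<in> {1..r}" "nth_prime i = nth_prime j"
  then have "i - 1 = j - 1"
    using strict_mono_eq[OF strict_mono_enumerate[OF infinite_primes_nat]]
    by (auto simp: nth_prime_def)
  with \<open>i \<in> _\<close> \<open>j \<in> _\<close> show "i = j" by auto
qed

text \<open>The enumeration of primes increases strictly, so the indices of primes up to
  \<open>n\<close> form an initial segment, whose length is \<open>prime_pi n\<close>.\<close>

lemma nth_prime_image: "nth_prime ` {1..prime_pi n} = {p. prime p \<and> p \<le> n}"
proof -
  let ?e = "enumerate {p :: nat. prime p}"
  let ?P = "{i. ?e i \<le> n}"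
  have mono: "strict_mono ?e" by (rule strict_mono_enumerate[OF infinite_primes_nat])
  have "bij_betw ?e UNIV {p. prime p}" by (rule bij_enumerate[OF infinite_primes_nat])
  then have img: "?e ` ?P = {p. prime p \<and> p \<le> n}"
    unfolding bij_betw_def by (auto simp: set_eq_iff image_iff) metis+
  have inj: "inj_on ?e ?P" by (meson strict_mono_imp_inj_on mono inj_on_subset subset_UNIV)
  have card: "card ?P = prime_pi n" unfolding prime_pi_def img[symmetric] by (simp add: card_image inj)
  have fin: "finite ?P"
    using img inj finite_imageD[of ?e ?P] by (metis (no_types, lifting) finite_nat_set_iff_bounded_le mem_Collect_eq)
  have "?P = {..<prime_pi n}"
  proof (rule card_subset_eq[symmetric])
    show "{..<prime_pi n} \<subseteq> ?P"
    proof
      fix i assume i: "i \<in> {..<prime_pi n}"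
      show "i \<in> ?P"
      proof (rule ccontr)
        \<comment> \<open>Monotonicity would put all of \<open>?P\<close> below \<open>i\<close>,
          leaving it at most \<open>i\<close> elements, fewer than
          \<open>prime_pi n\<close>.\<close>
        assume "i \<notin> ?P"
        then have "j < i" if "j \<in> ?P" for j
          using that strict_mono_less[OF mono, of j i] by simp
        then have "?P \<subseteq> {..<i}" by blast
        then have "card ?P \<le> i" using card_mono[of "{..<i}" ?P] by simp
        with i card show False by simp
      qed
    qed
  qed (use fin card in auto)
  moreover have "nth_prime ` {1..k} = ?e ` {..<k}" for k
  proof -
    \<comment> \<open>Indices of \<open>nth_prime\<close> start at 1, those of
      \<open>enumerate\<close> at 0.\<close>
    have "{1..k} = Suc ` {..<k}" by (simp add: image_Suc_lessThan)
    then show ?thesis by (simp add: image_image nth_prime_def)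
  qed
  ultimately show ?thesis using img by simp
qed

lemma weight_add: "weight r (a + b) = weight r a * weight r b"
  by (simp add: weight_def lookup_add power_add prod.distrib)

lemma weight_pos: "weight r e > 0"
  unfolding weight_def using prime_nth_prime by (intro prod_pos) (auto simp: prime_gt_0_nat)

text \<open>Distinct indices give distinct primes, so the product can be rewritten over primes,
  where multiplicities can be read off.\<close>

lemma multiplicity_weight:
  assumes "i \<in> {1..r}"
  shows "multiplicity (nth_prime i) (weight r e) = Poly_Mapping.lookup e i"
proof -
  let ?g = "inv_into {1..r} nth_prime"
  have "weight r e = (\<Prod>p\<in>nth_prime ` {1..r}. p ^ Poly_Mapping.lookup e (?g p))"
    by (simp add: weight_def prod.reindex inj_on_nth_prime del: One_nat_def)
  also have "multiplicity (nth_prime i) \<dots> = Poly_Mapping.lookup e (?g (nth_prime i))"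
    using assms prime_nth_prime by (subst multiplicity_prod_prime_powers) auto
  also have "\<dots> = Poly_Mapping.lookup e i" using assms by (simp only: inv_into_f_f[OF inj_on_nth_prime])
  finally show ?thesis .
qed

text \<open>Unique factorisation: multiplicities recover the exponents at \<open>1..r\<close>, and
  elements of \<open>exponents r\<close> vanish elsewhere.\<close>

lemma inj_on_weight: "inj_on (weight r) (exponents r)"
proof (rule inj_onI)
  fix d e assume de: "d \<in> exponents r" "e \<in> exponents r" "weight r d = weight r e"
  show "d = e"
  proof (rule poly_mapping_eqI)
    fix i show "Poly_Mapping.lookup d i = Poly_Mapping.lookup e i"
    proof (cases "i \<in> {1..r}")
      case True
      then show ?thesis using multiplicity_weight de(3) by metis
    next
      case False
      with de(1,2) show ?thesis by (metis (no_types, lifting) exponents_def in_keys_iff mem_Collect_eq subsetD)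
    qed
  qed
qed

lemma prime_dvd_weight:
  assumes "prime p" "p dvd weight (prime_pi n) e"
  shows "p \<le> n"
proof -
  obtain i where i: "i \<in> {1..prime_pi n}" "p dvd nth_prime i ^ Poly_Mapping.lookup e i"
    using assms by (auto simp: weight_def prime_dvd_prod_iff)
  have "p = nth_prime i"
    using assms(1) prime_nth_prime prime_dvd_power[OF assms(1) i(2)] by (rule primes_dvd_imp_eq)
  with i(1) have "p \<in> nth_prime ` {1..prime_pi n}" by simp
  then show ?thesis unfolding nth_prime_image by simp
qed

text \<open>The exponents are the multiplicities in \<open>W\<close> of the first
  \<open>prime_pi n\<close> primes, which by hypothesis include all prime divisors of
  \<open>W\<close>.\<close>

lemma weight_surj:
  assumes "W > 0" "\<And>p. prime p \<Longrightarrow> p dvd W \<Longrightarrow> p \<le> n"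
  obtains e where "e \<in> exponents (prime_pi n)" "weight (prime_pi n) e = W"
proof
  let ?r = "prime_pi n"
  define h where "h i = (if i \<in> {1..?r} then multiplicity (nth_prime i) W else 0)" for i
  define e where "e = Abs_poly_mapping h"
  have "finite {i. h i \<noteq> 0}" by (rule finite_subset[of _ "{1..?r}"]) (auto simp: h_def)
  then have lookup_e: "Poly_Mapping.lookup e = h" by (simp add: e_def lookup_Abs_poly_mapping)
  show "e \<in> exponents ?r" by (auto simp: exponents_def in_keys_iff lookup_e h_def split: if_splits)
  have "weight ?r e = (\<Prod>p\<in>nth_prime ` {1..?r}. p ^ multiplicity p W)"
    unfolding prod.reindex[OF inj_on_nth_prime]
    by (simp add: weight_def lookup_e h_def)
  \<comment> \<open>Primes up to \<open>n\<close> that do not divide \<open>W\<close> contribute a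
    factor 1.\<close>
  also have "\<dots> = (\<Prod>p\<in>prime_factors W. p ^ multiplicity p W)"
    unfolding nth_prime_image
  proof (rule prod.mono_neutral_right)
    show "prime_factors W \<subseteq> {p. prime p \<and> p \<le> n}"
      using assms(2) by (auto simp: in_prime_factors_iff)
    show "\<forall>p\<in>{p. prime p \<and> p \<le> n} - prime_factors W. p ^ multiplicity p W = 1"
      using assms(1) by (auto simp: in_prime_factors_iff not_dvd_imp_multiplicity_0)
  qed simp
  also have "\<dots> = W" using prime_factorization_nat[OF assms(1)] by simp
  finally show "weight ?r e = W" .
qed

section \<open>Minimal vectors and their weights\<close>

lemma upper_weight:
  "upper r {e \<in> exponents r. weight r e > n} = {e \<in> exponents r. weight r e > n}"
proof (intro equalityI subsetI)
  fix e assume "e \<in> upper r {e \<in> exponents r. weight r e > n}"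
  then obtain d c where "e \<in> exponents r" "weight r d > n" "e = d + c"
    by (auto simp: upper_def)
  moreover have "weight r d \<le> weight r (d + c)" using weight_pos[of r c] by (simp add: weight_add)
  ultimately show "e \<in> {e \<in> exponents r. weight r e > n}" by simp
qed (auto intro: upperI)

text \<open>Passing to a proper divisor strictly lowers the weight, so by induction on the weight
  every vector of \<open>A\<close> has a minimal one below it.\<close>

lemma upper_minimal_exponents:
  assumes "A \<subseteq> exponents r" "upper r A = A"
  shows "upper r (minimal_exponents A) = A"
proof
  show "upper r (minimal_exponents A) \<subseteq> A"
    using assms(2) by (auto simp: upper_def minimal_exponents_def)
  show "A \<subseteq> upper r (minimal_exponents A)"
  proof
    fix e assume "e \<in> A"
    then show "e \<in> upper r (minimal_exponents A)"
    proof (induction "weight r e" arbitrary: e rule: less_induct)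
      case less
      then have e: "e \<in> exponents r" using assms(1) by blast
      show ?case
      proof (cases "e \<in> minimal_exponents A")
        case True
        with e show ?thesis by (rule upperI[rotated])
      next
        case False
        then obtain d c where d: "d \<in> A" "e = d + c" "d \<noteq> e"
          using less.prems by (auto simp: minimal_exponents_def)
        have "weight r d \<le> weight r e" using weight_pos[of r c] by (simp add: d weight_add)
        \<comment> \<open>Injectivity of the weight makes the inequality strict.\<close>
        moreover have "weight r d \<noteq> weight r e"
          using inj_onD[OF inj_on_weight[of r], of d e] d(1,3) e assms(1) by blast
        ultimately have "d \<in> upper r (minimal_exponents A)" using less.hyps d by simp
        then obtain d' c' where d': "d' \<in> minimal_exponents A" "d = d' + c'"
          by (auto simp: upper_def)
        with d have "e = d' + (c' + c)" by (simp add: add.assoc)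
        with d'(1) e show ?thesis unfolding upper_def by blast
      qed
    qed
  qed
qed

text \<open>Every divisor of a weight is again a weight, so divisibility of vectors in
  \<open>exponents r\<close> matches divisibility of their weights. Minimality thus becomes the
  condition on proper divisors.\<close>

lemma weight_minimal_exponents:
  assumes "n \<ge> 1"
  defines "r \<equiv> prime_pi n"
  shows "weight r ` minimal_exponents {e \<in> exponents r. weight r e > n} =
    {W. composite W \<and> W \<ge> n + 1 \<and> (\<forall>d. d dvd W \<and> d \<noteq> W \<longrightarrow> d < n + 1)}"
    (is "weight r ` ?M = ?C")
proof (intro equalityI subsetI)
  fix W assume "W \<in> weight r ` ?M"
  then obtain e where W: "W = weight r e" and M: "e \<in> ?M" by blast
  then have e: "e \<in> exponents r" "W = weight r e" "W > n"
    by (simp_all add: minimal_exponents_def)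
  have min: "d = e" if "d \<in> exponents r" "weight r d > n" "e = d + c" for d c
    using M that unfolding minimal_exponents_def by blast
  have smooth: "p \<le> n" if "prime p" "p dvd W" for p
    using prime_dvd_weight that e(2) r_def by blast
  \<comment> \<open>A prime \<open>W\<close> would divide itself and so be at most \<open>n\<close>,
    against \<open>W > n\<close>; \<open>n \<ge> 1\<close> yields \<open>W > 1\<close>.\<close>
  have "composite W"
    using smooth[of W] e assms(1) by (auto simp: composite_def)
  moreover have "d < n + 1" if d: "d dvd W" "d \<noteq> W" for d
  proof (rule ccontr)
    assume "\<not> d < n + 1"
    from d obtain d' where d': "W = d * d'" by blast
    have pos: "d > 0" "d' > 0" using e d' by (auto intro: Nat.gr0I)
    \<comment> \<open>Both \<open>d\<close> and \<open>d'\<close> inherit the bound on prime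
      divisors and so are weights; by injectivity \<open>W = d * d'\<close> lifts to
      \<open>e = a + b\<close>.\<close>
    have "p \<le> n" if "prime p" "p dvd d" for p
      using smooth[of p] that by (simp add: d')
    with pos(1) obtain a where a: "a \<in> exponents r" "weight r a = d"
      unfolding r_def by (rule weight_surj)
    have "p \<le> n" if "prime p" "p dvd d'" for p
      using smooth[of p] that by (simp add: d')
    with pos(2) obtain b where b: "b \<in> exponents r" "weight r b = d'"
      unfolding r_def by (rule weight_surj)
    have "e = a + b"
      using inj_onD[OF inj_on_weight[of r]] a b e d' by (simp add: weight_add exponents_add_iff)
    \<comment> \<open>Since \<open>a\<close> has weight \<open>d > n\<close>, minimality forces
      \<open>a = e\<close>, whence \<open>d = W\<close>, although \<open>d\<close> was a proper
      divisor.\<close>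
    with min[of a b] a \<open>\<not> d < n + 1\<close> have "a = e" by simp
    with a d e show False by simp
  qed
  ultimately show "W \<in> ?C" using e by simp
next
  fix W assume "W \<in> ?C"
  then have W: "W > 1" "\<not> prime W" "W > n"
    and div: "\<And>d. d dvd W \<Longrightarrow> d \<noteq> W \<Longrightarrow> d \<le> n"
    by (auto simp: composite_def less_Suc_eq_le)
  \<comment> \<open>As \<open>W\<close> is not prime, \<open>p\<close> is a proper divisor of
    \<open>W\<close>.\<close>
  have "p \<le> n" if "prime p" "p dvd W" for p
    using div[of p] W(2) that by auto
  moreover have "W > 0" using W(1) by simp
  ultimately obtain e where e: "e \<in> exponents r" "weight r e = W"
    unfolding r_def using weight_surj by blast
  have "d = e" if "d \<in> exponents r" "weight r d > n" "e = d + c" for d c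
  proof -
    \<comment> \<open>A divisor of \<open>W\<close> exceeding \<open>n\<close> cannot be
      proper.\<close>
    have "weight r d dvd W" unfolding e(2)[symmetric] that(3) weight_add by simp
    with div[of "weight r d"] that(2) have "weight r d = W" by linarith
    with e that(1) show ?thesis by (intro inj_onD[OF inj_on_weight[of r]]) simp_all
  qed
  with e W(3) have "e \<in> ?M" unfolding minimal_exponents_def by blast
  with e show "W \<in> weight r ` ?M" by blast
qed

theorem corollary19:
  fixes n :: nat
  assumes "n \<ge> 1"
  shows "num_generators TYPE('k :: field_char_0) n = A182843 (n + 1)"
proof -
  define r where "r = prime_pi n"
  define A where "A = {e \<in> exponents r. weight r e > n}"
  have A: "A \<subseteq> exponents r" "upper r A = A" by (auto simp: A_def upper_weight)
  \<comment> \<open>Exactly one set satisfies the condition under the \<open>THE\<close>, so its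
    value is known; injectivity of \<open>monomial\<close> and of \<open>weight r\<close> then
    carries the count over to the integers \<open>W\<close>.\<close>
  have "is_minimal_monomial_generating_set r (weight_ideal n :: 'k mpoly set) G \<longleftrightarrow>
      G = monomial ` minimal_exponents A" for G
    using A upper_minimal_exponents[OF A]
    by (intro is_minimal_monomial_generating_set_iff)
      (simp_all add: weight_ideal_def r_def A_def Let_def)
  then have "num_generators TYPE('k) n =
      card (monomial ` minimal_exponents A :: 'k mpoly set)"
    by (simp add: num_generators_def minimal_monomial_generators_def flip: r_def)
  also have "\<dots> = card (minimal_exponents A)"
    by (rule card_image) (rule inj_on_subset[OF inj_monomial subset_UNIV])
  also have "\<dots> = card (weight r ` minimal_exponents A)"
    by (rule card_image[symmetric], rule inj_on_subset[OF inj_on_weight])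
      (use A in \<open>auto simp: minimal_exponents_def\<close>)
  also have "\<dots> = A182843 (n + 1)"
    using weight_minimal_exponents[OF assms] by (simp add: A182843_def A_def r_def)
  finally show ?thesis .
qed

end
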